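(* Let $p$ be a prime and let $(w_n)_{n\ge 1}$ be a sequence of positive integers such that $\lim_{n\to\infty}\left(w_n-\log_p(n)\right)=+\infty$. For each $n$, let $\overline{\mathbf{B}}_n$ be a uniform random element of the set $$\{B\in M_n(\mathbb{F}_p): B(i,j)=0\text{ for all } i,j\text{ such that } |i-j|>w_n\}.$$ For each $n$, let $\mathcal{E}_n$ be a deterministic subset of $\mathbb{F}_p^n\setminus\{0\}$, and assume that $\lim_{n\to\infty}\frac{|\mathcal{E}_n|}{p^n}=0$. Then $$\lim_{n\to\infty}\mathbb{P}(\ker\overline{\mathbf{B}}_n\cap\mathcal{E}_n\ne\emptyset)=0.$$
   Context: $\ker\overline{\mathbf{B}}_n=\{v\in\mathbb{F}_p^n:\overline{\mathbf{B}}_nv=0\}$. *)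

theory Defs
  imports
    "HOL-Probability.Probability"
    "Jordan_Normal_Form.Matrix_Kernel"
    "Berlekamp_Zassenhaus.Finite_Field"
begin

(* Indices run over {0..<n} instead of {1..n}; the condition depends only on i - j,
   which is taken in int because subtraction on nat truncates. *)
definition band_matrices :: "nat \<Rightarrow> nat \<Rightarrow> 'a::zero mat set" where
  "band_matrices n w =
     {B \<in> carrier_mat n n. \<forall>i<n. \<forall>j<n. \<bar>int i - int j\<bar> > int w \<longrightarrow> B $$ (i, j) = 0}"

(* pmf_of_set is only meaningful on finite nonempty sets, hence the next two facts. *)
lemma band_matrices_nonempty: "band_matrices n w \<noteq> {}"
proof -
  have "0\<^sub>m n n \<in> band_matrices n w"
    by (simp add: band_matrices_def)
  then show ?thesis by blast
qed

lemma finite_band_matrices: "finite (band_matrices n w :: 'a::{zero,finite} mat set)"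
proof -
  let ?F = "({0..<n} \<times> {0..<n}) \<rightarrow>\<^sub>E (UNIV :: 'a set)"
  have "(band_matrices n w :: 'a mat set) \<subseteq> mat n n ` ?F"
  proof
    fix B :: "'a mat"
    assume "B \<in> band_matrices n w"
    then have B: "B \<in> carrier_mat n n" by (simp add: band_matrices_def)
    have "B = mat n n (restrict (\<lambda>ij. B $$ ij) ({0..<n} \<times> {0..<n}))"
      using B by (intro eq_matI) auto
    moreover have "restrict (\<lambda>ij. B $$ ij) ({0..<n} \<times> {0..<n}) \<in> ?F" by auto
    ultimately show "B \<in> mat n n ` ?F" by (rule image_eqI)
  qed
  then show ?thesis
    by (rule finite_subset) (intro finite_imageI finite_PiE, auto)
qed

definition uniform_band_matrix :: "nat \<Rightarrow> nat \<Rightarrow> 'a::{zero,finite} mat pmf" where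
  "uniform_band_matrix n w = pmf_of_set (band_matrices n w)"

end

theory Submission
  imports Defs
begin

text \<open>Row \<open>i\<close> of \<open>B v\<close> is uniform if \<open>v\<close> has a nonzero entry within distance \<open>w\<close> of \<open>i\<close> (the row is
  covered) and is \<open>0\<close> otherwise, so \<open>P(B v = 0)\<close> is \<open>p\<close> to the minus number of covered rows. Vectors of
  \<open>\<E>\<close> covering all rows contribute at most \<open>|\<E>| / p\<^sup>n\<close>. If a nonzero kernel vector leaves a row
  uncovered, cutting it off at that row gives another kernel vector. Hence one of minimal
  support has an interval of covered rows, and these vectors are few enough
  for a union bound over the endpoints \<open>a \<le> b\<close> of the support: it gives \<open>2 x (2 + x)\<close> with
  \<open>x = n p\<^sup>-\<^sup>w\<close>.\<close>

unbundle no vec_syntax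

section \<open>Covered rows and the probability of annihilating a fixed vector\<close>

definition covered_rows :: "nat \<Rightarrow> nat \<Rightarrow> 'a::zero vec \<Rightarrow> nat set" where
  "covered_rows n w v = {i. i < n \<and> (\<exists>j<n. \<bar>int i - int j\<bar> \<le> int w \<and> v $ j \<noteq> 0)}"

lemma covered_rows_subset: "covered_rows n w v \<subseteq> {..<n}"
  by (auto simp: covered_rows_def)

lemma finite_covered_rows [simp]: "finite (covered_rows n w v)"
  by (rule finite_subset[OF covered_rows_subset]) simp

lemma band_matrix_entry_zero:
  "B \<in> band_matrices n w \<Longrightarrow> i < n \<Longrightarrow> j < n \<Longrightarrow> int w < \<bar>int i - int j\<bar> \<Longrightarrow> B $$ (i, j) = 0"
  by (auto simp: band_matrices_def)

lemma finite_carrier_vec: "finite (carrier_vec n :: 'a::finite vec set)"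
proof -
  have "(carrier_vec n :: 'a vec set) \<subseteq> vec n ` ({..<n} \<rightarrow>\<^sub>E (UNIV :: 'a set))"
  proof
    fix v :: "'a vec" assume "v \<in> carrier_vec n"
    then have "v = vec n (restrict (\<lambda>j. v $ j) {..<n})" by (intro eq_vecI) auto
    then show "v \<in> vec n ` ({..<n} \<rightarrow>\<^sub>E UNIV)"
      by (intro image_eqI[where x = "restrict (\<lambda>j. v $ j) {..<n}"]) auto
  qed
  then show ?thesis
    by (rule finite_subset) (intro finite_imageI finite_PiE, auto)
qed

lemma mat_kernel_iff:
  assumes "B \<in> carrier_mat n n" "v \<in> carrier_vec n"
  shows "v \<in> mat_kernel B \<longleftrightarrow> (\<forall>i<n. (\<Sum>j<n. B $$ (i, j) * v $ j) = 0)"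
proof -
  have "v \<in> mat_kernel B \<longleftrightarrow> B *\<^sub>v v = 0\<^sub>v n"
    using assms by (simp add: mat_kernel_def)
  also have "\<dots> \<longleftrightarrow> (\<forall>i<n. (B *\<^sub>v v) $ i = 0)"
    using assms by (metis carrier_matD(1) dim_mult_mat_vec eq_vecI index_zero_vec)
  also have "\<dots> \<longleftrightarrow> (\<forall>i<n. (\<Sum>j<n. B $$ (i, j) * v $ j) = 0)"
    using assms by (auto simp: scalar_prod_def lessThan_atLeast0)
  finally show ?thesis .
qed

text \<open>Adding arbitrary multiples of one matrix unit in each covered row to the matrices that
  annihilate \<open>v\<close> gives pairwise distinct band matrices.\<close>

lemma card_band_kernel:
  fixes v :: "'a::{field,finite} vec"
  assumes v: "v \<in> carrier_vec n"
  shows "card {B \<in> band_matrices n w. v \<in> mat_kernel B} * CARD('a) ^ card (covered_rows n w v)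
         \<le> card (band_matrices n w :: 'a mat set)"
proof -
  let ?R = "covered_rows n w v"
  let ?K = "{B \<in> band_matrices n w. v \<in> mat_kernel B}"
  let ?C = "?R \<rightarrow>\<^sub>E (UNIV :: 'a set)"
  \<comment> \<open>In a covered row \<open>i\<close>, \<open>J i\<close> is a column inside the
    band where \<open>v\<close> is nonzero: changing the entry at \<open>(i, J i)\<close> keeps the
    band shape and changes row \<open>i\<close> of the product with \<open>v\<close>.\<close>
  have "\<forall>i\<in>?R. \<exists>j. j < n \<and> \<bar>int i - int j\<bar> \<le> int w \<and> v $ j \<noteq> 0"
    by (auto simp: covered_rows_def)
  then obtain J where J: "\<And>i. i \<in> ?R \<Longrightarrow> J i < n \<and> \<bar>int i - int (J i)\<bar> \<le> int w \<and> v $ J i \<noteq> 0"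
    by metis
  define D where "D c = (\<lambda>(i, j). if i \<in> ?R \<and> j = J i then c i else 0)" for c :: "nat \<Rightarrow> 'a"
  define T where "T = (\<lambda>(B, c). mat n n (\<lambda>ij. B $$ ij + D c ij))"
  have dim: "B \<in> carrier_mat n n" if "B \<in> ?K" for B using that by (auto simp: band_matrices_def)
  \<comment> \<open>Since \<open>B\<close> annihilates \<open>v\<close>, row \<open>i\<close> of the
    product sees only the perturbation. As \<open>v $ J i\<close> is nonzero, \<open>c\<close> can
    be read off from \<open>T (B, c)\<close>, and then \<open>B\<close> as well.\<close>
  have row: "(\<Sum>j<n. T (B, c) $$ (i, j) * v $ j) = c i * v $ J i"
    if "B \<in> ?K" "i \<in> ?R" for B c i
  proof -
    have i: "i < n" using that by (auto simp: covered_rows_def)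
    have "(\<Sum>j<n. T (B, c) $$ (i, j) * v $ j)
        = (\<Sum>j<n. B $$ (i, j) * v $ j) + (\<Sum>j<n. D c (i, j) * v $ j)"
      using i by (simp add: T_def distrib_right sum.distrib)
    also have "(\<Sum>j<n. B $$ (i, j) * v $ j) = 0"
      using that i mat_kernel_iff[OF dim v] by blast
    also have "(\<Sum>j<n. D c (i, j) * v $ j) = (\<Sum>j<n. if j = J i then c i * v $ J i else 0)"
      using that by (intro sum.cong) (auto simp: D_def)
    also have "\<dots> = c i * v $ J i" using J[OF that(2)] by simp
    finally show ?thesis by simp
  qed
  have "inj_on T (?K \<times> ?C)"
  proof (rule inj_onI, clarify)
    fix B B' c c'
    assume B: "B \<in> band_matrices n w" "v \<in> mat_kernel B" and B': "B' \<in> band_matrices n w" "v \<in> mat_kernel B'"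
      and c: "c \<in> ?C" and c': "c' \<in> ?C" and eq: "T (B, c) = T (B', c')"
    have "c i = c' i" if "i \<in> ?R" for i
      using row[of B i c] row[of B' i c'] B B' eq J[OF that] that by simp
    then have cc: "c = c'" using c c' by (intro PiE_ext[of _ ?R]) auto
    have "B $$ (i, j) = B' $$ (i, j)" if "i < n" "j < n" for i j
    proof -
      have "T (B, c) $$ (i, j) = T (B', c') $$ (i, j)" using eq by simp
      then show ?thesis using that cc by (simp add: T_def)
    qed
    moreover have "B \<in> carrier_mat n n" "B' \<in> carrier_mat n n" using B B' dim by auto
    ultimately have "B = B'" by (intro eq_matI) auto
    with cc show "B = B' \<and> c = c'" by simp
  qed
  moreover have "T ` (?K \<times> ?C) \<subseteq> band_matrices n w"
  proof clarify
    fix B :: "'a mat" and c assume "B \<in> band_matrices n w"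
    then show "T (B, c) \<in> band_matrices n w"
      using J by (fastforce simp: T_def D_def band_matrices_def)
  qed
  ultimately have "card (?K \<times> ?C) \<le> card (band_matrices n w :: 'a mat set)"
    by (rule card_inj_on_le[OF _ _ finite_band_matrices])
  then show ?thesis
    by (simp add: card_cartesian_product card_PiE)
qed

lemma prob_in_kernel_le:
  fixes v :: "'a::{field,finite} vec"
  assumes "v \<in> carrier_vec n"
  shows "measure_pmf.prob (uniform_band_matrix n w) {B. v \<in> mat_kernel B}
         \<le> 1 / real CARD('a) ^ card (covered_rows n w v)"
proof -
  let ?S = "band_matrices n w :: 'a mat set"
  have pos: "real (card ?S) > 0"
    by (simp add: card_gt_0_iff finite_band_matrices band_matrices_nonempty)
  have "real (card {B \<in> ?S. v \<in> mat_kernel B}) * real CARD('a) ^ card (covered_rows n w v)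
      \<le> real (card ?S)"
    using card_band_kernel[OF assms, of w] by (simp only: of_nat_le_iff flip: of_nat_mult of_nat_power)
  then have "real (card {B \<in> ?S. v \<in> mat_kernel B}) / real (card ?S)
      * real CARD('a) ^ card (covered_rows n w v) \<le> 1"
    using pos by simp
  then have "real (card {B \<in> ?S. v \<in> mat_kernel B}) / real (card ?S)
      \<le> 1 / real CARD('a) ^ card (covered_rows n w v)"
    by (subst pos_le_divide_eq) auto
  moreover have "measure_pmf.prob (uniform_band_matrix n w) {B. v \<in> mat_kernel B}
      = real (card {B \<in> ?S. v \<in> mat_kernel B}) / real (card ?S)"
    unfolding uniform_band_matrix_def
    by (subst measure_pmf_of_set)
       (auto simp: finite_band_matrices band_matrices_nonempty Int_def intro!: arg_cong[where f = card])
  ultimately show ?thesis by simp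
qed

section \<open>Truncation and minimal kernel vectors\<close>

text \<open>As row \<open>m\<close> is uncovered, \<open>v\<close> vanishes on all columns within
  distance \<open>w\<close> of \<open>m\<close>. Rows up to \<open>m\<close> therefore meet no
  nonzero entry of \<open>v\<close> from \<open>m\<close> on, and give the same value on
  \<open>v\<close> and on the truncation; rows beyond \<open>m\<close> meet no nonzero entry before
  \<open>m\<close>, and give zero on the truncation.\<close>

lemma truncation_in_kernel:
  fixes B :: "'a::field mat"
  assumes B: "B \<in> band_matrices n w" and v: "v \<in> carrier_vec n" "v \<in> mat_kernel B"
    and m: "m < n" "m \<notin> covered_rows n w v"
  shows "vec n (\<lambda>j. if j < m then v $ j else 0) \<in> mat_kernel B"
proof -
  let ?t = "vec n (\<lambda>j. if j < m then v $ j else 0)"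
  have gap: "v $ j = 0" if "j < n" "\<bar>int m - int j\<bar> \<le> int w" for j
    using m that by (auto simp: covered_rows_def)
  have carrier: "B \<in> carrier_mat n n" using B by (simp add: band_matrices_def)
  have ker: "(\<Sum>j<n. B $$ (i, j) * v $ j) = 0" if "i < n" for i
    using mat_kernel_iff[OF carrier v(1)] v(2) that by blast
  have "(\<Sum>j<n. B $$ (i, j) * ?t $ j) = 0" if i: "i < n" for i
  proof (cases "i \<le> m")
    case True
    have "B $$ (i, j) * ?t $ j = B $$ (i, j) * v $ j" if "j < n" for j
    proof (cases "j < m \<or> v $ j = 0")
      case False
      then have "B $$ (i, j) = 0"
        using band_matrix_entry_zero[OF B i that] gap[OF that] True by force
      then show ?thesis by simp
    qed (use that in auto)
    then have "(\<Sum>j<n. B $$ (i, j) * ?t $ j) = (\<Sum>j<n. B $$ (i, j) * v $ j)"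
      by (intro sum.cong) auto
    then show ?thesis using ker[OF i] by simp
  next
    case False
    have "B $$ (i, j) * ?t $ j = 0" if "j < n" for j
    proof (cases "j < m \<and> v $ j \<noteq> 0")
      case True
      then have "B $$ (i, j) = 0"
        using band_matrix_entry_zero[OF B i that] gap[OF that] False by force
      then show ?thesis by simp
    qed (use that in auto)
    then show ?thesis by (intro sum.neutral) auto
  qed
  then show ?thesis by (subst mat_kernel_iff[OF carrier]) auto
qed

text \<open>The condition on covered rows says that the support leaves no gap: every row within
  reach of the interval from \<open>a\<close> to \<open>b\<close> is covered. It fixes the number of
  covered rows in terms of \<open>a\<close> and \<open>b\<close> alone. The entries at
  \<open>a\<close> and \<open>b\<close> themselves may be zero.\<close>

definition cluster_vectors :: "nat \<Rightarrow> nat \<Rightarrow> nat \<Rightarrow> nat \<Rightarrow> 'a::zero vec set" where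
  "cluster_vectors n w a b = {v \<in> carrier_vec n. (\<forall>j<n. v $ j \<noteq> 0 \<longrightarrow> a \<le> j \<and> j \<le> b) \<and>
     covered_rows n w v = {i. i < n \<and> a \<le> i + w \<and> i \<le> b + w}}"

text \<open>The vector \<open>u\<close> has the least support among the nonzero kernel vectors with
  an uncovered row. The disjunction records that the first or the last row is uncovered, which is
  the source of a factor \<open>1 / q ^ w\<close> in the union bound.\<close>

lemma exists_cluster_in_kernel:
  fixes B :: "'a::field mat"
  assumes B: "B \<in> band_matrices n w" and v: "v \<in> carrier_vec n" "v \<in> mat_kernel B" "v \<noteq> 0\<^sub>v n"
    and nonfull: "covered_rows n w v \<noteq> {..<n}"
  obtains a b u where "a \<le> b" "b < n" "w < a \<or> b + w + 1 < n"
    "u \<in> cluster_vectors n w a b" "u \<in> mat_kernel B"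
proof -
  define supp where "supp u = {j. j < n \<and> u $ j \<noteq> 0}" for u :: "'a vec"
  \<comment> \<open>The uncovered row is part of the minimized property, so that the minimizer
    retains one; truncating at an uncovered row preserves this, since that row stays
    uncovered.\<close>
  define P where "P u \<longleftrightarrow> u \<in> carrier_vec n \<and> u \<in> mat_kernel B \<and> supp u \<noteq> {} \<and>
      covered_rows n w u \<noteq> {..<n}" for u
  have fin: "finite (supp u)" for u by (simp add: supp_def)
  have "supp v \<noteq> {}" using v by (auto simp: supp_def intro!: eq_vecI)
  then have "P v" using v nonfull by (simp add: P_def)
  then obtain u where u: "P u" and min: "\<And>u'. P u' \<Longrightarrow> card (supp u) \<le> card (supp u')"
    using ex_has_least_nat[of P v "\<lambda>u. card (supp u)"] by blast
  have uc: "u \<in> carrier_vec n" and uk: "u \<in> mat_kernel B" and ne: "supp u \<noteq> {}"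
    and unf: "covered_rows n w u \<noteq> {..<n}" using u by (auto simp: P_def)
  define a b where "a = Min (supp u)" and "b = Max (supp u)"
  have a: "a \<in> supp u" and b: "b \<in> supp u" using fin ne by (auto simp: a_def b_def)
  have ab: "a \<le> j \<and> j \<le> b" if "j \<in> supp u" for j using fin that by (auto simp: a_def b_def)
  have cov: "i \<in> covered_rows n w u" if i: "i < n" "a \<le> i + w" "i \<le> b + w" for i
  proof (rule ccontr)
    assume i': "i \<notin> covered_rows n w u"
    have gap: "j + w < i \<or> i + w < j" if "j \<in> supp u" for j
    proof (rule ccontr)
      assume "\<not> ?thesis"
      then have "\<bar>int i - int j\<bar> \<le> int w" by linarith
      with that i i' show False by (auto simp: covered_rows_def supp_def)
    qed
    \<comment> \<open>Cutting at \<open>i\<close> thus keeps the entry at \<open>a\<close> and drops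
      the one at \<open>b\<close>: the support shrinks without becoming empty.\<close>
    have "a + w < i" "i + w < b" using gap[OF a] gap[OF b] i by auto
    let ?t = "vec n (\<lambda>j. if j < i then u $ j else 0)"
    have supp: "supp ?t = {j \<in> supp u. j < i}"
      by (auto simp: supp_def split: if_splits)
    have "i \<notin> covered_rows n w ?t" using i i' by (auto simp: covered_rows_def)
    moreover have "a \<in> supp ?t" using a \<open>a + w < i\<close> by (simp add: supp)
    ultimately have "P ?t"
      using truncation_in_kernel[OF B uc uk i(1) i'] i(1) by (auto simp: P_def)
    then have "card (supp u) \<le> card (supp ?t)" by (rule min)
    moreover have "b \<notin> supp ?t" unfolding supp using \<open>i + w < b\<close> by simp
    then have "supp ?t \<subset> supp u" using b unfolding supp by blast
    then have "card (supp ?t) < card (supp u)" by (rule psubset_card_mono[OF fin])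
    ultimately show False by linarith
  qed
  have covered: "covered_rows n w u = {i. i < n \<and> a \<le> i + w \<and> i \<le> b + w}"
  proof (intro equalityI subsetI)
    fix i assume "i \<in> covered_rows n w u"
    then obtain j where "i < n" "j \<in> supp u" "\<bar>int i - int j\<bar> \<le> int w"
      by (auto simp: covered_rows_def supp_def)
    with ab[of j] show "i \<in> {i. i < n \<and> a \<le> i + w \<and> i \<le> b + w}" by auto
  qed (use cov in auto)
  show thesis
  proof
    show "a \<le> b" using ab[OF a] by simp
    show "b < n" using b by (simp add: supp_def)
    show "w < a \<or> b + w + 1 < n"
      using unf unfolding covered by (rule contrapos_np) auto
    show "u \<in> cluster_vectors n w a b"
      using uc covered ab by (auto simp: cluster_vectors_def supp_def)
  qed (rule uk)
qed

section \<open>Counting cluster vectors and summing their probabilities\<close>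

lemma card_cluster_vectors_le:
  assumes "a \<le> b" "b < n"
  shows "card (cluster_vectors n w a b :: 'a::{zero,finite} vec set) \<le> CARD('a) ^ (b + 1 - a)"
proof -
  let ?V = "cluster_vectors n w a b :: 'a vec set"
  let ?f = "\<lambda>v :: 'a vec. restrict (\<lambda>j. v $ j) {a..b}"
  have "inj_on ?f ?V"
  proof (rule inj_onI)
    fix u v assume u: "u \<in> ?V" and v: "v \<in> ?V" and eq: "?f u = ?f v"
    have "u $ j = v $ j" if "j < n" for j
    proof (cases "j \<in> {a..b}")
      case True
      then show ?thesis using fun_cong[OF eq, of j] by simp
    next
      case False
      then show ?thesis using u v that by (auto simp: cluster_vectors_def)
    qed
    then show "u = v" using u v by (intro eq_vecI) (auto simp: cluster_vectors_def)
  qed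
  moreover have "?f ` ?V \<subseteq> {a..b} \<rightarrow>\<^sub>E UNIV" by auto
  ultimately have "card ?V \<le> card ({a..b} \<rightarrow>\<^sub>E (UNIV :: 'a set))"
    by (intro card_inj_on_le) (auto intro: finite_PiE)
  then show ?thesis by (simp add: card_PiE)
qed

text \<open>The interval from \<open>a\<close> to \<open>b\<close> grows by \<open>w\<close> rows on
  each side, clipped at \<open>0\<close> and at \<open>n - 1\<close>; the two minima count the rows
  gained.\<close>

lemma card_covered_rows_cluster:
  assumes "a \<le> b" "b < n" "v \<in> cluster_vectors n w a b"
  shows "card (covered_rows n w v) = min w a + (b + 1 - a) + min w (n - 1 - b)"
proof -
  have "covered_rows n w v = {i. i < n \<and> a \<le> i + w \<and> i \<le> b + w}"
    using assms(3) by (simp add: cluster_vectors_def)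
  also have "\<dots> = {a - w..<min n (b + w + 1)}" by auto
  finally have "card (covered_rows n w v) = min n (b + w + 1) - (a - w)" by simp
  then show ?thesis using assms(1,2) by linarith
qed

text \<open>Each term is \<open>1 / q ^ k\<close> or \<open>1 / q ^ w\<close>, hence at most the sum
  of both. The constant 2 bounds the geometric series with ratio 1/2.\<close>

lemma sum_inverse_power_min_le:
  assumes "q \<ge> (2::real)"
  shows "(\<Sum>k<n. 1 / q ^ min w k) \<le> 2 + real n / q ^ w"
proof -
  have "(\<Sum>k<n. 1 / q ^ min w k) \<le> (\<Sum>k<n. (1 / 2) ^ k + 1 / q ^ w)"
  proof (rule sum_mono)
    fix k
    have "1 / q ^ k \<le> (1 / 2) ^ k"
      using assms by (simp add: power_one_over frac_le power_mono)
    moreover have "0 \<le> 1 / q ^ w" "0 \<le> (1 / 2 :: real) ^ k" using assms by auto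
    ultimately show "1 / q ^ min w k \<le> (1 / 2) ^ k + 1 / q ^ w"
      unfolding min_def by (simp only: split: if_split) linarith
  qed
  also have "\<dots> = (\<Sum>k<n. (1 / 2) ^ k) + real n / q ^ w" by (simp add: sum.distrib)
  also have "(\<Sum>k<n. (1 / 2 :: real) ^ k) \<le> 2" by (subst sum_gp_strict) simp
  finally show ?thesis by simp
qed

text \<open>The reflection of \<open>b\<close> to \<open>n - 1 - b\<close> permutes
  \<open>{..<n}\<close>, so both summands contribute equally.\<close>

lemma double_sum_reflected:
  fixes f :: "nat \<Rightarrow> real"
  shows "(\<Sum>a<n. \<Sum>b<n. f a + f (n - 1 - b)) = 2 * real n * (\<Sum>k<n. f k)"
  using sum.nat_diff_reindex[of f n] by (simp add: sum.distrib flip: sum_distrib_left)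

text \<open>The number of vectors, at most \<open>q ^ (b + 1 - a)\<close> for field size
  \<open>q\<close>, cancels the rows from \<open>a\<close> to \<open>b\<close>. Only the rows gained
  at the two sides remain, one factor for each side.\<close>

lemma sum_cluster_vectors_le:
  assumes ab: "a \<le> b" "b < n"
  shows "(\<Sum>v\<in>cluster_vectors n w a b. 1 / real CARD('a::{field,finite}) ^ card (covered_rows n w (v :: 'a vec)))
         \<le> 1 / real CARD('a) ^ min w a * (1 / real CARD('a) ^ min w (n - 1 - b))"
proof -
  let ?q = "real CARD('a)"
  let ?V = "cluster_vectors n w a b :: 'a vec set"
  have "(\<Sum>v\<in>?V. 1 / ?q ^ card (covered_rows n w v))
      = (\<Sum>v\<in>?V. 1 / ?q ^ (min w a + (b + 1 - a) + min w (n - 1 - b)))"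
    by (intro sum.cong refl) (simp only: card_covered_rows_cluster[OF ab])
  also have "\<dots> = real (card ?V) / ?q ^ (min w a + (b + 1 - a) + min w (n - 1 - b))"
    by simp
  also have "\<dots> \<le> ?q ^ (b + 1 - a) / ?q ^ (min w a + (b + 1 - a) + min w (n - 1 - b))"
    using card_cluster_vectors_le[OF ab, of w, where 'a = 'a]
    by (intro divide_right_mono) (simp_all only: of_nat_le_iff of_nat_0_le_iff zero_le_power flip: of_nat_power)
  also have "\<dots> = 1 / ?q ^ min w a * (1 / ?q ^ min w (n - 1 - b))"
    by (simp only: power_add) simp
  finally show ?thesis .
qed

section \<open>The union bound\<close>

text \<open>The first term counts the vectors of \<open>E\<close> that cover all rows. Any other
  vector of \<open>E\<close> in the kernel is traded for a cluster vector, which may lie outside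
  \<open>E\<close>; hence the second term does not depend on \<open>E\<close>.\<close>

lemma prob_kernel_meets_le:
  fixes E :: "'a::{field,finite} vec set"
  assumes E: "E \<subseteq> carrier_vec n - {0\<^sub>v n}"
  defines "q \<equiv> real CARD('a)"
  shows "measure_pmf.prob (uniform_band_matrix n w) {B. mat_kernel B \<inter> E \<noteq> {}}
         \<le> real (card E) / q ^ n + 2 * (real n / q ^ w) * (2 + real n / q ^ w)"
proof -
  let ?M = "uniform_band_matrix n w :: 'a mat pmf"
  define K where "K v = {B :: 'a mat. v \<in> mat_kernel B}" for v
  define F where "F = {v \<in> E. covered_rows n w v = {..<n}}"
  define I where "I = {(a, b). a \<le> b \<and> b < n \<and> (w < a \<or> b + w + 1 < n)}"
  let ?V = "\<lambda>(a, b). cluster_vectors n w a b :: 'a vec set"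
  have two: "q \<ge> 2"
  proof -
    have "card {0, 1 :: 'a} \<le> CARD('a)" by (intro card_mono) auto
    then show ?thesis by (simp add: q_def)
  qed
  have finE: "finite E" by (rule finite_subset[OF E]) (simp add: finite_carrier_vec)
  have finF: "finite F" using finE by (simp add: F_def)
  have finI: "finite I" by (rule finite_subset[of _ "{..<n} \<times> {..<n}"]) (auto simp: I_def)
  have V: "?V ab \<subseteq> carrier_vec n" for ab by (auto simp: cluster_vectors_def split: prod.splits)
  then have finV: "finite (?V ab)" for ab by (rule finite_subset[OF _ finite_carrier_vec])
  have union: "measure_pmf.prob ?M (\<Union>v\<in>S. K v) \<le> (\<Sum>v\<in>S. 1 / q ^ card (covered_rows n w v))"
    if "finite S" "S \<subseteq> carrier_vec n" for S
  proof -
    have "measure_pmf.prob ?M (\<Union>v\<in>S. K v) \<le> (\<Sum>v\<in>S. measure_pmf.prob ?M (K v))"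
      using that by (intro measure_pmf.finite_measure_subadditive_finite) auto
    also have "\<dots> \<le> (\<Sum>v\<in>S. 1 / q ^ card (covered_rows n w v))"
      unfolding K_def q_def using that by (intro sum_mono prob_in_kernel_le) auto
    finally show ?thesis .
  qed
  have supp: "set_pmf ?M = band_matrices n w"
    by (simp add: uniform_band_matrix_def finite_band_matrices band_matrices_nonempty)
  \<comment> \<open>Intersecting with the support of the distribution restricts to band matrices,
    for which cluster vectors are available.\<close>
  have incl: "{B. mat_kernel B \<inter> E \<noteq> {}} \<inter> set_pmf ?M \<subseteq> (\<Union>v\<in>F. K v) \<union> (\<Union>ab\<in>I. \<Union>v\<in>?V ab. K v)"
  proof
    fix B assume "B \<in> {B. mat_kernel B \<inter> E \<noteq> {}} \<inter> set_pmf ?M"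
    then obtain v where B: "B \<in> band_matrices n w" and v: "v \<in> mat_kernel B" "v \<in> E"
      by (auto simp: supp)
    show "B \<in> (\<Union>v\<in>F. K v) \<union> (\<Union>ab\<in>I. \<Union>v\<in>?V ab. K v)"
    proof (cases "covered_rows n w v = {..<n}")
      case True
      then show ?thesis using v by (auto simp: F_def K_def)
    next
      case False
      have "v \<in> carrier_vec n" "v \<noteq> 0\<^sub>v n" using v E by auto
      from exists_cluster_in_kernel[OF B this(1) v(1) this(2) False]
      obtain a b u where "a \<le> b" "b < n" "w < a \<or> b + w + 1 < n"
        "u \<in> cluster_vectors n w a b" "u \<in> mat_kernel B" .
      then have "(a, b) \<in> I" "u \<in> ?V (a, b)" "B \<in> K u" by (simp_all add: I_def K_def)
      then show ?thesis by blast
    qed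
  qed
  have "measure_pmf.prob ?M {B. mat_kernel B \<inter> E \<noteq> {}}
      = measure_pmf.prob ?M ({B. mat_kernel B \<inter> E \<noteq> {}} \<inter> set_pmf ?M)"
    by (simp add: measure_Int_set_pmf)
  also have "\<dots> \<le> measure_pmf.prob ?M ((\<Union>v\<in>F. K v) \<union> (\<Union>ab\<in>I. \<Union>v\<in>?V ab. K v))"
    using incl by (intro measure_pmf.finite_measure_mono) auto
  also have "\<dots> \<le> measure_pmf.prob ?M (\<Union>v\<in>F. K v) + measure_pmf.prob ?M (\<Union>ab\<in>I. \<Union>v\<in>?V ab. K v)"
    by (intro measure_subadditive) (auto simp: measure_pmf.emeasure_eq_measure)
  also have "measure_pmf.prob ?M (\<Union>v\<in>F. K v) \<le> real (card E) / q ^ n"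
  proof -
    have "measure_pmf.prob ?M (\<Union>v\<in>F. K v) \<le> (\<Sum>v\<in>F. 1 / q ^ card (covered_rows n w v))"
      using finF E by (intro union) (auto simp: F_def)
    also have "\<dots> = real (card F) / q ^ n" by (simp add: F_def)
    also have "\<dots> \<le> real (card E) / q ^ n"
      using finE two by (intro divide_right_mono) (auto simp: F_def intro!: card_mono)
    finally show ?thesis .
  qed
  also have "measure_pmf.prob ?M (\<Union>ab\<in>I. \<Union>v\<in>?V ab. K v) \<le> 2 * (real n / q ^ w) * (2 + real n / q ^ w)"
  proof -
    let ?f = "\<lambda>k. 1 / q ^ min w k"
    let ?g = "\<lambda>(a, b). 1 / q ^ w * (?f a + ?f (n - 1 - b))"
    have pos: "?f k \<ge> 0" for k using two by simp
    have "measure_pmf.prob ?M (\<Union>ab\<in>I. \<Union>v\<in>?V ab. K v)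
        \<le> (\<Sum>ab\<in>I. measure_pmf.prob ?M (\<Union>v\<in>?V ab. K v))"
      using finI by (intro measure_pmf.finite_measure_subadditive_finite) auto
    also have "\<dots> \<le> (\<Sum>ab\<in>I. ?g ab)"
    proof (rule sum_mono)
      fix ab assume "ab \<in> I"
      then obtain a b where ab: "ab = (a, b)" "a \<le> b" "b < n" "w < a \<or> b + w + 1 < n"
        by (auto simp: I_def)
      have "measure_pmf.prob ?M (\<Union>v\<in>?V ab. K v) \<le> ?f a * ?f (n - 1 - b)"
        using union[OF finV V, of ab] sum_cluster_vectors_le[OF ab(2,3), of w, where 'a = 'a]
        unfolding q_def ab(1) by simp
      \<comment> \<open>One of the two factors is exactly \<open>1 / q ^ w\<close> by the
        disjunction in \<open>I\<close>. Bounding the other by the sum of both gives one expression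
        for both cases, in which \<open>a\<close> and \<open>b\<close> separate.\<close>
      also have "\<dots> \<le> 1 / q ^ w * (?f a + ?f (n - 1 - b))"
      proof (cases "w < a")
        case True
        then have "?f a = 1 / q ^ w" by simp
        then show ?thesis using pos two by (simp add: distrib_left)
      next
        case False
        then have "?f (n - 1 - b) = 1 / q ^ w" using ab by simp
        then show ?thesis using pos two by (simp add: distrib_left mult.commute)
      qed
      finally show "measure_pmf.prob ?M (\<Union>v\<in>?V ab. K v) \<le> ?g ab" by (simp add: ab)
    qed
    \<comment> \<open>The terms are nonnegative, so \<open>I\<close> may be enlarged to the full
      square.\<close>
    also have "\<dots> \<le> (\<Sum>ab\<in>{..<n} \<times> {..<n}. ?g ab)"
      using two by (intro sum_mono2) (auto simp: I_def)
    also have "\<dots> = 1 / q ^ w * (\<Sum>a<n. \<Sum>b<n. ?f a + ?f (n - 1 - b))"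
      by (simp only: sum_distrib_left sum.cartesian_product case_prod_unfold)
    also have "(\<Sum>a<n. \<Sum>b<n. ?f a + ?f (n - 1 - b)) = 2 * real n * (\<Sum>k<n. ?f k)"
      by (rule double_sum_reflected)
    also have "1 / q ^ w * (2 * real n * (\<Sum>k<n. ?f k)) = 2 * (real n / q ^ w) * (\<Sum>k<n. ?f k)"
      by simp
    also have "\<dots> \<le> 2 * (real n / q ^ w) * (2 + real n / q ^ w)"
      using two by (intro mult_left_mono sum_inverse_power_min_le) auto
    finally show ?thesis .
  qed
  finally show ?thesis by simp
qed

section \<open>Passage to the limit\<close>

text \<open>For positive \<open>n\<close> the quotient is \<open>exp\<close> of
  \<open>- ln p\<close> times the gap between \<open>w n\<close> and \<open>log p n\<close>, and
  \<open>ln p\<close> is positive.\<close>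

lemma tendsto_divide_power_log_gap:
  fixes p :: real
  assumes "p > 1" and "filterlim (\<lambda>n. real (w n) - log p (real n)) at_top sequentially"
  shows "(\<lambda>n. real n / p ^ w n) \<longlonglongrightarrow> 0"
proof -
  have "filterlim (\<lambda>n. ln p * (real (w n) - log p (real n))) at_top sequentially"
    using assms by (intro filterlim_tendsto_pos_mult_at_top[OF tendsto_const]) auto
  then have "(\<lambda>n. exp (- (ln p * (real (w n) - log p (real n))))) \<longlonglongrightarrow> 0"
    by (intro filterlim_compose[OF exp_at_bot]) (simp add: filterlim_uminus_at_bot)
  moreover have "\<forall>\<^sub>F n in sequentially.
      exp (- (ln p * (real (w n) - log p (real n)))) = real n / p ^ w n"
    using eventually_gt_at_top[of 0]
  proof eventually_elim
    case (elim n)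
    have "exp (- (ln p * (real (w n) - log p (real n)))) = exp (ln (real n) - real (w n) * ln p)"
      using assms by (simp add: log_def algebra_simps)
    also have "\<dots> = real n / p ^ w n"
      using assms elim by (simp add: exp_diff exp_of_nat_mult)
    finally show ?case .
  qed
  ultimately show ?thesis by (rule Lim_transform_eventually)
qed

theorem theorem4:
  fixes p :: nat
    and w :: "nat \<Rightarrow> nat"
    and \<E> :: "nat \<Rightarrow> 'p::prime_card mod_ring vec set"
  assumes "prime p" and "CARD('p) = p"
    and "\<And>n. n \<ge> 1 \<Longrightarrow> w n > 0"
    and "filterlim (\<lambda>n. real (w n) - log (real p) (real n)) at_top sequentially"
    and "\<And>n. n \<ge> 1 \<Longrightarrow> \<E> n \<subseteq> carrier_vec n - {0\<^sub>v n}"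
    and "(\<lambda>n. real (card (\<E> n)) / real p ^ n) \<longlonglongrightarrow> 0"
  shows "(\<lambda>n. measure_pmf.prob (uniform_band_matrix n (w n))
            {B. mat_kernel B \<inter> \<E> n \<noteq> {}}) \<longlonglongrightarrow> 0"
proof -
  let ?x = "\<lambda>n. real n / real p ^ w n"
  have card: "CARD('p mod_ring) = p" using assms(2) by simp
  have "?x \<longlonglongrightarrow> 0"
    using assms(1,4) prime_gt_1_nat by (intro tendsto_divide_power_log_gap) auto
  then have "(\<lambda>n. real (card (\<E> n)) / real p ^ n + 2 * ?x n * (2 + ?x n)) \<longlonglongrightarrow> 0 + 2 * 0 * (2 + 0)"
    using assms(6) by (intro tendsto_intros)
  then have upper: "(\<lambda>n. real (card (\<E> n)) / real p ^ n + 2 * ?x n * (2 + ?x n)) \<longlonglongrightarrow> 0" by simp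
  have le: "\<forall>\<^sub>F n in sequentially. measure_pmf.prob (uniform_band_matrix n (w n))
      {B. mat_kernel B \<inter> \<E> n \<noteq> {}} \<le> real (card (\<E> n)) / real p ^ n + 2 * ?x n * (2 + ?x n)"
    \<comment> \<open>The assumption on \<open>\<E> n\<close> is available from \<open>n = 1\<close>
      on.\<close>
    using eventually_ge_at_top[of 1]
  proof eventually_elim
    case (elim n)
    then show ?case using prob_kernel_meets_le[OF assms(5)[OF elim], of "w n"] by (simp only: card)
  qed
  show ?thesis
    by (rule tendsto_sandwich[OF always_eventually le tendsto_const upper]) simp
qed

end
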